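(* Let $X$ and $Y$ be two random variables with interval supports and quantile and density functions $F^{-1}$, $f$ and $G^{-1}$, $g$, respectively. Assume that $p\mapsto \frac{f(F^{-1}(p))}{g(G^{-1}(p))}$ on $(0,1)$ has a finite number $n\ge1$ of modes, located at $0<p_1<\cdots<p_n<1$, such that the first one occurs from increasing to decreasing (so the ratio is increasing on $(0,p_1)$, decreasing on $(p_1,p_2)$, and so on alternately, up to $(p_n,1)$). Then $X\le_{\mathrm{qmit}}Y$ if, and only if, one of the following sets of conditions is satisfied: (a) $n=2m$ and $$\int_0^{p_{2i}} q\left(\frac{f(F^{-1}(p_{2i}))}{g(G^{-1}(p_{2i}))}\frac{1}{f(F^{-1}(q))}-\frac{1}{g(G^{-1}(q))}\right)dq\ge0,\quad\text{for } i=1,\dots,m;$$ (b) $n=2m+1$, $$\int_0^{p_{2i}} q\left(\frac{f(F^{-1}(p_{2i}))}{g(G^{-1}(p_{2i}))}\frac{1}{f(F^{-1}(q))}-\frac{1}{g(G^{-1}(q))}\right)dq\ge0,\quad\text{for } i=1,\dots,m,$$ and $$\lim_{p\to1^-}\left[\frac{f(F^{-1}(p))}{g(G^{-1}(p))}\bigl(F^{-1}(p)-E[X]\bigr)-\bigl(G^{-1}(p)-E[Y]\bigr)\right]\ge0.$$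
   Context: Standing assumptions: $X$ and $Y$ are non-negative, have finite expectation, distribution functions $F$ and $G$, density functions $f$ and $g$, and interval supports $(l_X,u_X)$ and $(l_Y,u_Y)$ (bounded or unbounded). The quantile function is $F^{-1}(p)=\inf\{x\in\mathbb R: F(x)\ge p\}$, $p\in(0,1)$, and similarly for $G^{-1}$; quantile functions are differentiable on $(0,1)$ with $\frac{d}{dp}F^{-1}(p)=1/f(F^{-1}(p))$ and $\frac{d}{dp}G^{-1}(p)=1/g(G^{-1}(p))$. "Increasing" and "decreasing" are used in the non-strict sense. A mode of a function means a relative extreme (maximum or minimum), i.e. a point at which the function changes from increasing to decreasing or from decreasing to increasing. Limits are taken in the extended reals. The qmit order: $X\le_{\mathrm{qmit}}Y$ means that $$\frac{\int_{l_Y}^{G^{-1}(p)}G(x)\,dx}{\int_{l_X}^{F^{-1}(p)}F(x)\,dx}=\frac{\int_0^p \frac{q}{g(G^{-1}(q))}\,dq}{\int_0^p \frac{q}{f(F^{-1}(q))}\,dq}$$ is increasing in $p\in(0,1)$. *)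

theory Defs
  imports "HOL-Probability.Probability"
begin

definition quantile :: "(real \<Rightarrow> real) \<Rightarrow> real \<Rightarrow> real" where
  "quantile F p = Inf {x. p \<le> F x}"

definition measure_support :: "real measure \<Rightarrow> real set" where
  "measure_support D = {x. \<forall>S. open S \<and> x \<in> S \<longrightarrow> 0 < emeasure D S}"

text \<open>
  The support of a law is a closed set, so having the interval support \<open>(l, u)\<close> means that it is
  the closure of \<open>(l, u)\<close>. The left endpoint is real since \<open>X\<close> is non-negative;
  the right endpoint may be infinite.

  The positivity assumption \<open>density_quantile_pos\<close> is implicit in the derivative formula for the
  quantile function: it has to be stated because \<open>1 / 0 = 0\<close> in HOL.
\<close>

locale nonneg_rv = prob_space M for M :: "'a measure" +
  fixes X :: "'a \<Rightarrow> real" and F f :: "real \<Rightarrow> real" and l :: real and u :: ereal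
  assumes nonneg: "AE \<omega> in M. 0 \<le> X \<omega>"
    and finite_expectation: "integrable M X"
    and distribution_function: "F = cdf (distr M borel X)"
    and density_nonneg: "\<And>x. 0 \<le> f x"
    and density: "distributed M lborel X (\<lambda>x. ennreal (f x))"
    and endpoints: "ereal l < u"
    and interval_support: "measure_support (distr M borel X) = closure (einterval (ereal l) u)"
    and density_quantile_pos: "\<And>p. p \<in> {0<..<1} \<Longrightarrow> 0 < f (quantile F p)"
    and quantile_deriv:
      "\<And>p. p \<in> {0<..<1} \<Longrightarrow> (quantile F has_real_derivative 1 / f (quantile F p)) (at p)"

text \<open>
  The order \<open>X \<le>\<^sub>q\<^sub>m\<^sub>i\<^sub>t Y\<close>, in terms of the left endpoints of the supports and the
  distribution functions of \<open>X\<close> and \<open>Y\<close>.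
\<close>

definition qmit_le :: "real \<Rightarrow> (real \<Rightarrow> real) \<Rightarrow> real \<Rightarrow> (real \<Rightarrow> real) \<Rightarrow> bool" where
  "qmit_le lX F lY G \<longleftrightarrow>
     mono_on {0<..<1}
       (\<lambda>p. (LBINT x=ereal lY..ereal (quantile G p). G x) /
            (LBINT x=ereal lX..ereal (quantile F p). F x))"

text \<open>
  The function \<open>r\<close> on \<open>(0, 1)\<close> has \<open>n\<close> modes \<open>p 1 < \<dots> < p n\<close>, the first one from increasing to
  decreasing. The values \<open>p 0 = 0\<close> and \<open>p (n + 1) = 1\<close> are the ends of the domain. Monotonicity is
  non-strict, so a plateau is allowed on either side of a mode.
\<close>

definition modes_from_increasing :: "(real \<Rightarrow> real) \<Rightarrow> nat \<Rightarrow> (nat \<Rightarrow> real) \<Rightarrow> bool" where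
  "modes_from_increasing r n p \<longleftrightarrow>
     p 0 = 0 \<and> p (n + 1) = 1 \<and> (\<forall>i\<le>n. p i < p (i + 1)) \<and>
     (\<forall>i\<le>n. even i \<longrightarrow> mono_on {p i<..<p (i + 1)} r) \<and>
     (\<forall>i\<le>n. odd i \<longrightarrow> antimono_on {p i<..<p (i + 1)} r)"

end

theory Submission
  imports Defs
begin

text \<open>
  Let \<open>A(p)\<close> and \<open>B(p)\<close> be the integrals of \<open>q / f (quantile F q)\<close> and \<open>q / g (quantile G q)\<close> over \<open>(0, p)\<close>, so that
  \<open>r = B' / A'\<close>. The derivative of \<open>B / A\<close> has the sign of \<open>H = r A - B\<close>, and by Cauchy's mean value
  theorem \<open>H\<close> is monotone in the same direction as \<open>r\<close> on every interval between two modes. Since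
  \<open>H\<close> is non-negative up to the first mode, it is non-negative everywhere iff it is so at the local
  minima \<open>p 2, p 4, \<dots>\<close> of \<open>r\<close> and, if \<open>r\<close> is finally decreasing, in the limit at \<open>1\<close>. In that case \<open>r\<close> is
  bounded near \<open>1\<close>, and the expression in the limit condition differs from \<open>H\<close> by
  \<open>E[(Y - quantile G p)\<^sup>+] - r(p) E[(X - quantile F p)\<^sup>+]\<close>, which tends to \<open>0\<close>.
\<close>

section \<open>Fundamental theorem of calculus and ratios of derivatives\<close>

text \<open>
  Unlike \<open>interval_integral_FTC_nonneg\<close>, this does not need \<open>h\<close> to be continuous: the densities,
  and hence the derivatives of the quantile functions, need not be.
\<close>

lemma interval_integral_FTC_nonneg_measurable:
  fixes A h :: "real \<Rightarrow> real"
  assumes "a < b"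
    and deriv: "\<And>x. a < x \<Longrightarrow> x < b \<Longrightarrow> (A has_real_derivative h x) (at x)"
    and left: "(A \<longlongrightarrow> \<alpha>) (at_right a)" and right: "isCont A b"
    and nonneg: "\<And>x. a < x \<Longrightarrow> x < b \<Longrightarrow> 0 \<le> h x"
    and meas: "set_borel_measurable borel {a<..<b} h"
  shows "interval_lebesgue_integrable lborel (ereal a) (ereal b) h"
    and "(LBINT x=ereal a..ereal b. h x) = A b - \<alpha>"
proof -
  \<comment> \<open>\<open>A\<close> is known near \<open>a\<close> only through its right limit.
    Changing its value at \<open>a\<close> to that limit makes it continuous on the closed
    interval.\<close>
  define A' where "A' = A(a := \<alpha>)"
  have ev: "\<forall>\<^sub>F y in nhds x. A y = A' y" if "a < x" for x
    using that by (auto simp: A'_def eventually_nhds intro!: exI[of _ "{a<..}"])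
  have "continuous_on {a..b} A'"
    unfolding continuous_on_eq_continuous_within
  proof
    fix x assume x: "x \<in> {a..b}"
    show "continuous (at x within {a..b}) A'"
    proof (cases "x = a")
      case True
      have "(A' \<longlongrightarrow> \<alpha>) (at_right a)"
        by (rule Lim_transform_eventually[OF left]) (auto simp: A'_def eventually_at_filter)
      then show ?thesis
        using True \<open>a < b\<close> by (simp add: continuous_within A'_def at_within_Icc_at_right)
    next
      case False
      then have "a < x" using x by auto
      have "isCont A x"
        using x False right deriv[of x] by (cases "x = b") (auto intro: DERIV_isCont)
      then have "isCont A' x"
        using isCont_cong[OF ev[OF \<open>a < x\<close>]] by simp
      then show ?thesis by (rule continuous_at_imp_continuous_at_within)
    qed
  qed
  moreover have "(A' has_vector_derivative h x) (at x)" if "x \<in> {a<..<b}" for x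
  proof -
    have "(A' has_real_derivative h x) (at x)"
      using that deriv[of x] DERIV_cong_ev[OF refl ev[of x] refl] by auto
    then show ?thesis by (simp add: has_real_derivative_iff_has_vector_derivative)
  qed
  \<comment> \<open>For the gauge integral every derivative is integrable, so no regularity of
    \<open>h\<close> is needed here. The sign of \<open>h\<close> then makes the integral absolute,
    and Borel measurability carries it over to \<open>lborel\<close>.\<close>
  ultimately have "(h has_integral (A' b - A' a)) {a..b}"
    using \<open>a < b\<close> by (intro fundamental_theorem_of_calculus_interior) auto
  then have int: "(h has_integral (A b - \<alpha>)) {a<..<b}"
    using \<open>a < b\<close> by (simp add: A'_def has_integral_Icc_iff_Ioo)
  have "h absolutely_integrable_on {a<..<b}"
    using int nonneg by (intro nonnegative_absolutely_integrable_1) (auto simp: integrable_on_def)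
  then have lb: "set_integrable lborel {a<..<b} h"
    using meas unfolding set_integrable_def set_borel_measurable_def
    by (subst (asm) integrable_completion) auto
  then show "interval_lebesgue_integrable lborel (ereal a) (ereal b) h"
    using \<open>a < b\<close> by (simp add: interval_lebesgue_integrable_def)
  show "(LBINT x=ereal a..ereal b. h x) = A b - \<alpha>"
    using set_borel_integral_eq_integral(2)[OF lb] int \<open>a < b\<close>
    by (simp add: interval_lebesgue_integral_def integral_unique)
qed

lemma less_of_DERIV_pos:
  fixes A a :: "real \<Rightarrow> real"
  assumes "x < y"
    and "\<And>q. q \<in> {x..y} \<Longrightarrow> (A has_real_derivative a q) (at q)"
    and "\<And>q. q \<in> {x..y} \<Longrightarrow> 0 < a q"
  shows "A x < A y"
proof (rule DERIV_pos_imp_increasing[OF \<open>x < y\<close>])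
  fix q assume "x \<le> q" "q \<le> y"
  then show "\<exists>d. (A has_real_derivative d) (at q) \<and> 0 < d"
    using assms by (intro exI[of _ "a q"]) auto
qed

text \<open>The common factor \<open>a z\<close> cancels from Cauchy's formula because it is
  positive. Increments of \<open>B\<close> are thereby compared with increments of \<open>A\<close>
  although \<open>r\<close> may be discontinuous.\<close>

lemma cauchy_mean_value:
  fixes A B a r :: "real \<Rightarrow> real"
  assumes "x < y"
    and A: "\<And>q. q \<in> {x..y} \<Longrightarrow> (A has_real_derivative a q) (at q)"
    and B: "\<And>q. q \<in> {x..y} \<Longrightarrow> (B has_real_derivative r q * a q) (at q)"
    and pos: "\<And>q. q \<in> {x..y} \<Longrightarrow> 0 < a q"
  obtains z where "x < z" "z < y" "B y - B x = r z * (A y - A x)"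
proof -
  have "\<exists>z. x < z \<and> z < y \<and> (A y - A x) * (r z * a z) = (B y - B x) * a z"
    using assms by (intro GMVT') (auto intro: DERIV_isCont less_imp_le)
  then obtain z where z: "x < z" "z < y" "(A y - A x) * (r z * a z) = (B y - B x) * a z"
    by blast
  then have "B y - B x = r z * (A y - A x)" using pos[of z] by (simp add: mult.commute)
  with z that show thesis by blast
qed

text \<open>
  The function \<open>r = B' / A'\<close> is a quotient of two derivatives, so that its value at an
  endpoint is a limit of values inside: difference quotients are values of \<open>r\<close>
  by Cauchy's mean value theorem.
\<close>

lemma mono_on_derivative_ratio_closed:
  fixes A B a r :: "real \<Rightarrow> real"
  assumes A: "\<And>q. q \<in> {x..y} \<Longrightarrow> (A has_real_derivative a q) (at q)"
    and B: "\<And>q. q \<in> {x..y} \<Longrightarrow> (B has_real_derivative r q * a q) (at q)"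
    and pos: "\<And>q. q \<in> {x..y} \<Longrightarrow> 0 < a q"
    and mono: "mono_on {x<..<y} r"
  shows "mono_on {x..y} r"
proof -
  have incr: "A s < A t" if "x \<le> s" "s < t" "t \<le> y" for s t
    by (rule less_of_DERIV_pos[where a = a]) (use that A pos in auto)
  have slope: "\<exists>z. s < z \<and> z < t \<and> (B t - B s) / (A t - A s) = r z"
    if st: "x \<le> s" "s < t" "t \<le> y" for s t
  proof -
    obtain z where "s < z" "z < t" "B t - B s = r z * (A t - A s)"
      by (rule cauchy_mean_value[of s t A a B r]) (use st A B pos in auto)
    then show ?thesis using incr[OF st] by (intro exI[of _ z]) auto
  qed
  have lim: "((\<lambda>t. (B t - B s) / (A t - A s)) \<longlongrightarrow> r s) (at s)" if "s \<in> {x..y}" for s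
  proof -
    have "((\<lambda>t. ((B t - B s) / (t - s)) / ((A t - A s) / (t - s))) \<longlongrightarrow> r s * a s / a s) (at s)"
      using A[OF that] B[OF that] pos[OF that]
      by (intro tendsto_divide) (auto simp: has_field_derivative_iff)
    then have "((\<lambda>t. ((B t - B s) / (t - s)) / ((A t - A s) / (t - s))) \<longlongrightarrow> r s) (at s)"
      using pos[OF that] by simp
    then show ?thesis
      by (rule Lim_transform_eventually) (auto simp: eventually_at_filter)
  qed
  have left: "r x \<le> r q" if "x < q" "q < y" for q
  proof (rule tendsto_upperbound)
    show "((\<lambda>t. (B t - B x) / (A t - A x)) \<longlongrightarrow> r x) (at_right x)"
      using lim[of x] that by (auto intro: filterlim_mono[OF _ order_refl at_le])
    have "(B t - B x) / (A t - A x) \<le> r q" if t: "x < t" "t < q" for t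
    proof -
      obtain z where "x < z" "z < t" "(B t - B x) / (A t - A x) = r z"
        using slope[of x t] t \<open>q < y\<close> by auto
      then show ?thesis using t \<open>q < y\<close> monotone_onD[OF mono, of z q] by auto
    qed
    then show "\<forall>\<^sub>F t in at_right x. (B t - B x) / (A t - A x) \<le> r q"
      using \<open>x < q\<close> by (auto simp: eventually_at_right intro!: exI[of _ q])
  qed simp
  have right: "r q \<le> r y" if "x < q" "q < y" for q
  proof (rule tendsto_lowerbound)
    show "((\<lambda>t. (B t - B y) / (A t - A y)) \<longlongrightarrow> r y) (at_left y)"
      using lim[of y] that by (auto intro: filterlim_mono[OF _ order_refl at_le])
    have "r q \<le> (B t - B y) / (A t - A y)" if t: "q < t" "t < y" for t
    proof -
      obtain z where z: "t < z" "z < y" "(B y - B t) / (A y - A t) = r z"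
        using slope[of t y] t \<open>x < q\<close> by auto
      have "(B t - B y) / (A t - A y) = (B y - B t) / (A y - A t)"
        by (metis minus_diff_eq minus_divide_divide)
      then show ?thesis using t z \<open>x < q\<close> monotone_onD[OF mono, of q z] by auto
    qed
    then show "\<forall>\<^sub>F t in at_left y. r q \<le> (B t - B y) / (A t - A y)"
      using \<open>q < y\<close> by (auto simp: eventually_at_left intro!: exI[of _ q])
  qed simp
  show ?thesis
  proof (rule monotone_onI)
    fix s t assume st: "s \<in> {x..y}" "t \<in> {x..y}" "s \<le> t"
    consider "s = t" | "x < s" "t < y" | "s = x" "t < y" "s < t" | "x < s" "t = y" "s < t"
      | "s = x" "t = y" "x < y"
      using st by fastforce
    then show "r s \<le> r t"
    proof cases
      case 2 then show ?thesis using monotone_onD[OF mono, of s t] st by auto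
    next
      case 5
      then show ?thesis using left[of "(x + y) / 2"] right[of "(x + y) / 2"] by auto
    qed (use left right in auto)
  qed
qed

lemma antimono_on_iff_mono_on_uminus:
  fixes r :: "real \<Rightarrow> real"
  shows "antimono_on S r \<longleftrightarrow> mono_on S (\<lambda>q. - r q)"
  by (simp add: monotone_on_def)

lemma modes_strict_mono:
  assumes "modes_from_increasing r n p" "i < j" "j \<le> n + 1"
  shows "p i < p j"
  using assms(2,3)
proof (induction j)
  case (Suc j)
  then have "p j < p (Suc j)" using assms(1) by (auto simp: modes_from_increasing_def)
  with Suc show ?case by (cases "i = j") auto
qed simp

lemma modes_in_unit_interval:
  assumes "modes_from_increasing r n p" "1 \<le> i" "i \<le> n"
  shows "p i \<in> {0<..<1}"
  using modes_strict_mono[OF assms(1), of 0 i] modes_strict_mono[OF assms(1), of i "n + 1"] assms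
  by (auto simp: modes_from_increasing_def)

section \<open>Sign of \<open>H\<close> in terms of the modes of \<open>r\<close>\<close>

locale derivative_ratio =
  fixes A B a r :: "real \<Rightarrow> real"
  assumes A: "\<And>q. q \<in> {0<..<1} \<Longrightarrow> (A has_real_derivative a q) (at q)"
    and B: "\<And>q. q \<in> {0<..<1} \<Longrightarrow> (B has_real_derivative r q * a q) (at q)"
    and pos: "\<And>q. q \<in> {0<..<1} \<Longrightarrow> 0 < a q"
    and A_pos: "\<And>q. q \<in> {0<..<1} \<Longrightarrow> 0 < A q"
    and A_0: "(A \<longlongrightarrow> 0) (at_right 0)" and B_0: "(B \<longlongrightarrow> 0) (at_right 0)"
begin

text \<open>\<open>H\<close> has the sign of the derivative of \<open>B / A\<close>.\<close>

definition H :: "real \<Rightarrow> real" where "H q = r q * A q - B q"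

lemma mono_on_ratio_iff: "mono_on {0<..<1} (\<lambda>q. B q / A q) \<longleftrightarrow> (\<forall>q\<in>{0<..<1}. 0 \<le> H q)"
proof -
  have D: "((\<lambda>q. B q / A q) has_real_derivative a q * H q / (A q * A q)) (at q)"
    if "q \<in> {0<..<1}" for q
    by (rule derivative_eq_intros A B that refl)+
      (use A_pos[OF that] in \<open>auto simp: H_def algebra_simps\<close>)
  show ?thesis
  proof
    assume mono: "mono_on {0<..<1} (\<lambda>q. B q / A q)"
    show "\<forall>q\<in>{0<..<1}. 0 \<le> H q"
    proof
      fix q :: real assume q: "q \<in> {0<..<1}"
      have "0 \<le> a q * H q / (A q * A q)"
        using q by (intro mono_on_imp_deriv_nonneg[OF mono D]) (auto simp: interior_open)
      then show "0 \<le> H q"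
        using pos[OF q] mult_pos_pos[OF A_pos[OF q] A_pos[OF q]]
        by (simp add: zero_le_divide_iff zero_le_mult_iff)
    qed
  next
    assume H: "\<forall>q\<in>{0<..<1}. 0 \<le> H q"
    show "mono_on {0<..<1} (\<lambda>q. B q / A q)"
    proof (rule monotone_onI)
      fix s t :: real assume st: "s \<in> {0<..<1}" "t \<in> {0<..<1}" "s \<le> t"
      show "B s / A s \<le> B t / A t"
      proof (rule DERIV_nonneg_imp_nondecreasing[OF \<open>s \<le> t\<close>])
        fix q assume "s \<le> q" "q \<le> t"
        then have "q \<in> {0<..<1}" using st by auto
        then show "\<exists>d. DERIV (\<lambda>q. B q / A q) q :> d \<and> 0 \<le> d"
          using D[of q] H pos[of q] by (intro exI[of _ "a q * H q / (A q * A q)"]) simp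
      qed
    qed
  qed
qed

text \<open>The modes are defined through open intervals, which leaves the values at the modes to be
  recovered. The ends 0 and 1, where nothing is known about the derivatives, are cut off by working
  on compact subintervals \<open>{s..t}\<close>.\<close>

lemma mono_on_closed:
  assumes "x \<ge> 0" "y \<le> 1" "mono_on {x<..<y} r"
  shows "mono_on ({x..y} \<inter> {0<..<1}) r"
proof (rule monotone_onI)
  fix s t assume st: "s \<in> {x..y} \<inter> {0<..<1}" "t \<in> {x..y} \<inter> {0<..<1}" "s \<le> t"
  have "mono_on {s..t} r"
    using st assms A B pos
    by (intro mono_on_derivative_ratio_closed[of s t A a B]) (auto intro: mono_on_subset)
  then show "r s \<le> r t" using st by (auto simp: monotone_on_def)
qed

lemma mono_on_H:
  assumes "x \<ge> 0" "y \<le> 1" "mono_on {x<..<y} r"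
  shows "mono_on ({x..y} \<inter> {0<..<1}) H"
proof (rule monotone_onI)
  fix s t assume st: "s \<in> {x..y} \<inter> {0<..<1}" "t \<in> {x..y} \<inter> {0<..<1}" "s \<le> t"
  show "H s \<le> H t"
  proof (cases "s = t")
    case False
    note r = monotone_onD[OF mono_on_closed[OF assms]]
    obtain z where z: "s < z" "z < t" "B t - B s = r z * (A t - A s)"
      by (rule cauchy_mean_value[of s t A a B r]) (use st False A B pos in auto)
    have "A s < A t"
      by (rule less_of_DERIV_pos[where a = a]) (use st False A pos in auto)
    \<comment> \<open>This replaces the formal derivative \<open>r' * A\<close> of \<open>H\<close>,
      since \<open>r\<close> need not be differentiable. Both summands are non-negative because
      \<open>r s\<close> and \<open>r z\<close> are at most \<open>r t\<close>.\<close>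
    have "H t - H s = (r t - r s) * A s + (r t - r z) * (A t - A s)"
      using z(3) by (simp add: H_def algebra_simps)
    also have "\<dots> \<ge> 0"
      using st z \<open>A s < A t\<close> A_pos[of s] r[of s t] r[of z t]
      by (intro add_nonneg_nonneg mult_nonneg_nonneg) auto
    finally show ?thesis by simp
  qed simp
qed

text \<open>Negating \<open>B\<close> and \<open>r\<close> turns \<open>H\<close> into
  \<open>- H\<close>. The locale demands positivity only of \<open>A\<close> and \<open>a\<close>,
  so it admits this change.\<close>

lemma antimono_on_H:
  assumes "x \<ge> 0" "y \<le> 1" "antimono_on {x<..<y} r"
  shows "antimono_on ({x..y} \<inter> {0<..<1}) H"
proof -
  interpret neg: derivative_ratio A "\<lambda>q. - B q" a "\<lambda>q. - r q"
    using A B pos A_pos A_0 B_0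
    by unfold_locales (auto intro!: derivative_eq_intros tendsto_eq_intros)
  have "neg.H = (\<lambda>q. - H q)" by (auto simp: neg.H_def H_def)
  then show ?thesis
    using neg.mono_on_H assms by (simp add: antimono_on_iff_mono_on_uminus)
qed

text \<open>By the mean value theorem, \<open>H s\<close> exceeds \<open>r s * A t - B t\<close> by
  \<open>(r s - r z) * (A s - A t)\<close>, which is non-negative for \<open>r\<close> increasing.
  The smaller quantity vanishes as \<open>t\<close> tends to 0.\<close>

lemma H_nonneg_first:
  assumes "0 < y" "y \<le> 1" "mono_on {0<..<y} r" "s \<in> {0<..<1}" "s \<le> y"
  shows "0 \<le> H s"
proof -
  have "((\<lambda>t. r s * A t - B t) \<longlongrightarrow> r s * 0 - 0) (at_right 0)"
    by (intro tendsto_intros A_0 B_0)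
  moreover have "r s * A t - B t \<le> H s" if t: "0 < t" "t < s" for t
  proof -
    obtain z where z: "t < z" "z < s" "B s - B t = r z * (A s - A t)"
      by (rule cauchy_mean_value[of t s A a B r]) (use t assms A B pos in auto)
    have "A t < A s"
      by (rule less_of_DERIV_pos[where a = a]) (use t assms A pos in auto)
    moreover have "r z \<le> r s"
      using monotone_onD[OF mono_on_closed[OF _ assms(2,3)], of z s] z t assms by auto
    ultimately have "r z * (A s - A t) \<le> r s * (A s - A t)"
      by (intro mult_right_mono) auto
    then show ?thesis using z(3) by (simp add: H_def algebra_simps)
  qed
  then have "\<forall>\<^sub>F t in at_right 0. r s * A t - B t \<le> H s"
    using assms by (auto simp: eventually_at_right intro!: exI[of _ s])
  ultimately show ?thesis
    using tendsto_upperbound[of "\<lambda>t. r s * A t - B t" "r s * 0 - 0" "at_right 0" "H s"] by simp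
qed

text \<open>An increasing piece of \<open>H\<close> is smallest at its left end and a decreasing one
  at its right end. After the first piece these ends are modes of even index, except for a final
  decreasing piece, whose right end 1 enters through a limit.\<close>

lemma H_nonneg_iff:
  assumes modes: "modes_from_increasing r n p" and n: "1 \<le> n"
  shows "(\<forall>q\<in>{0<..<1}. 0 \<le> H q) \<longleftrightarrow>
    (\<exists>m. n = 2 * m \<and> (\<forall>i\<in>{1..m}. 0 \<le> H (p (2 * i)))) \<or>
    (\<exists>m. n = 2 * m + 1 \<and> (\<forall>i\<in>{1..m}. 0 \<le> H (p (2 * i))) \<and>
       (\<exists>L::ereal. ((\<lambda>q. ereal (H q)) \<longlongrightarrow> L) (at_left 1) \<and> 0 \<le> L))"
  (is "?nonneg \<longleftrightarrow> ?even \<or> ?odd")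
proof -
  have p: "p 0 = 0" "p (n + 1) = 1" "\<And>i. i \<le> n \<Longrightarrow> p i < p (i + 1)"
    and mono: "\<And>i. i \<le> n \<Longrightarrow> even i \<Longrightarrow> mono_on {p i<..<p (i + 1)} r"
    and anti: "\<And>i. i \<le> n \<Longrightarrow> odd i \<Longrightarrow> antimono_on {p i<..<p (i + 1)} r"
    using modes by (auto simp: modes_from_increasing_def)
  note p_less = modes_strict_mono[OF modes] and p_in = modes_in_unit_interval[OF modes]
  have p_ge: "0 \<le> p i" "p i \<le> 1" if "i \<le> n + 1" for i
    using p_less[of 0 i] p_less[of i "n + 1"] that p by (cases "i = 0"; cases "i = n + 1"; auto)+
  have H_mono: "H s \<le> H t" if "i \<le> n" "even i" "p i \<le> s" "s \<le> t" "t \<le> p (i + 1)" "0 < s" "t < 1" for i s t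
    using that mono_on_H[OF p_ge(1)[of i] p_ge(2)[of "i + 1"] mono[of i]] by (auto simp: monotone_on_def)
  have H_anti: "H t \<le> H s" if "i \<le> n" "odd i" "p i \<le> s" "s \<le> t" "t \<le> p (i + 1)" "0 < s" "t < 1" for i s t
    using that antimono_on_H[OF p_ge(1)[of i] p_ge(2)[of "i + 1"] anti[of i]] by (auto simp: monotone_on_def)
  have all: "0 \<le> H q"
    if q: "q \<in> {0<..<1}" and even: "\<And>i. even i \<Longrightarrow> 1 \<le> i \<Longrightarrow> i \<le> n \<Longrightarrow> 0 \<le> H (p i)"
      and last: "odd n \<Longrightarrow> p n \<le> q \<Longrightarrow> 0 \<le> H q" for q
  proof -
    \<comment> \<open>The index of the last division point not beyond \<open>q\<close>; maximality
      puts \<open>q\<close> in the piece from \<open>p i\<close> to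
      \<open>p (i + 1)\<close>.\<close>
    define i where "i = (GREATEST i. i \<le> n \<and> p i \<le> q)"
    have i: "i \<le> n \<and> p i \<le> q"
      unfolding i_def by (rule GreatestI_nat[of _ 0 n]) (use q p in auto)
    have q_less: "q < p (i + 1)"
    proof (rule ccontr)
      assume *: "\<not> q < p (i + 1)"
      then have "i + 1 \<le> n" using i q p(2) by (cases "i = n") auto
      then have "i + 1 \<le> i" unfolding i_def using *
        by (intro Greatest_le_nat[of _ _ n]) (auto simp: i_def)
      then show False by simp
    qed
    consider "i = 0" | "even i" "1 \<le> i" | "odd i" "i < n" | "odd i" "i = n"
      using i by (cases "i = 0"; cases "i = n"; auto)
    then show ?thesis
    proof cases
      case 1
      then show ?thesis
        using q q_less p p_in[of 1] n mono[of 0] by (intro H_nonneg_first[of "p 1"]) auto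
    next
      case 2
      then show ?thesis
        using H_mono[of i "p i" q] even[of i] p_in[of i] i q q_less by auto
    next
      case 3
      then show ?thesis
        using H_anti[of i q "p (i + 1)"] even[of "i + 1"] p_in[of "i + 1"] i q q_less by auto
    next
      case 4
      then show ?thesis using last i by auto
    qed
  qed
  show ?thesis
  proof
    assume H: ?nonneg
    then have at_p: "0 \<le> H (p (2 * i))" if "1 \<le> i" "2 * i \<le> n" for i
      using p_in[of "2 * i"] that by auto
    show "?even \<or> ?odd"
    proof (cases "even n")
      case True
      then obtain m where m: "n = 2 * m" by blast
      then show ?thesis using at_p by auto
    next
      case False
      then obtain m where m: "n = 2 * m + 1" by (rule oddE)
      \<comment> \<open>\<open>H\<close> is decreasing on the last piece, so its limit at 1 exists
        in the extended reals and equals the infimum.\<close>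
      define L where "L = (INF q\<in>{p n..<1}. ereal (H q))"
      have "0 \<le> L"
        unfolding L_def using H p_in[of n] n by (auto intro!: INF_greatest)
      moreover have "((\<lambda>q. ereal (H q)) \<longlongrightarrow> L) (at_left 1)"
      proof (rule decreasing_tendsto)
        show "\<forall>\<^sub>F q in at_left 1. L \<le> ereal (H q)"
          using p_in[of n] n by (auto simp: eventually_at_left L_def intro!: exI[of _ "p n"] INF_lower)
        fix x assume "L < x"
        then obtain s where s: "s \<in> {p n..<1}" "ereal (H s) < x"
          by (auto simp: L_def INF_less_iff)
        have "ereal (H q) < x" if "s < q" "q < 1" for q
        proof -
          have "H q \<le> H s" using that s False n p_in[of n] p by (intro H_anti[of n]) auto
          then show ?thesis using s(2) by (metis ereal_less_eq(3) le_less_trans)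
        qed
        then show "\<forall>\<^sub>F q in at_left 1. ereal (H q) < x"
          using s by (auto simp: eventually_at_left intro!: exI[of _ s])
      qed
      ultimately show ?thesis using m at_p by auto
    qed
  next
    assume R: "?even \<or> ?odd"
    then have even: "0 \<le> H (p i)" if "even i" "1 \<le> i" "i \<le> n" for i
      using that by (elim evenE) auto
    have last: "0 \<le> H q" if "odd n" "p n \<le> q" "q \<in> {0<..<1}" for q
    proof -
      obtain L :: ereal where L: "((\<lambda>q. ereal (H q)) \<longlongrightarrow> L) (at_left 1)" "0 \<le> L"
        using R \<open>odd n\<close> by auto
      \<comment> \<open>Beyond \<open>q\<close> the function \<open>H\<close> only decreases, so its
        limit bounds \<open>H q\<close> from below.\<close>
      have "\<forall>\<^sub>F t in at_left 1. ereal (H t) \<le> ereal (H q)"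
        using that p by (auto simp: eventually_at_left intro!: exI[of _ q] H_anti[of n])
      then have "L \<le> ereal (H q)"
        by (intro tendsto_upperbound[OF L(1)]) auto
      then show ?thesis using L(2) by (metis ereal_less_eq(5) order_trans)
    qed
    show ?nonneg using all even last by blast
  qed
qed

end

section \<open>Distribution and quantile function of a single variable\<close>

context nonneg_rv
begin

lemma X_measurable [measurable]: "X \<in> borel_measurable M"
  using finite_expectation by simp

lemma f_measurable [measurable]: "f \<in> borel_measurable borel"
  using distributed_real_measurable[OF _ density] density_nonneg by simp

sublocale law: real_distribution "distr M borel X"
  by (rule real_distribution_distr) simp

lemma F_eq: "F x = prob {\<omega> \<in> space M. X \<omega> \<le> x}"
  by (simp add: distribution_function cdf_def measure_distr vimage_def Int_def conj_commute)

lemma F_mono: "x \<le> y \<Longrightarrow> F x \<le> F y"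
  by (simp add: distribution_function law.cdf_nondecreasing)

lemma F_nonneg: "0 \<le> F x"
  by (simp add: F_eq)

lemma isCont_F: "isCont F x"
proof -
  have "emeasure (distr M borel X) {x} = (\<integral>\<^sup>+y. ennreal (f y) * indicator {x} y \<partial>lborel)"
    by (subst emeasure_distr) (simp_all add: distributed_emeasure[OF density])
  also have "\<dots> = 0"
    by (subst nn_integral_0_iff_AE) (auto intro!: eventually_mono[OF AE_lborel_singleton[of x]])
  finally have "measure (distr M borel X) {x} = 0"
    by (simp add: measure_def)
  then show ?thesis
    by (simp add: distribution_function law.isCont_cdf)
qed

text \<open>Continuity of \<open>F\<close> makes the set in the definition of the quantile closed,
  so its infimum is attained. Points to the left of the quantile have \<open>F\<close> below
  \<open>q\<close>, and letting them approach it gives the equality.\<close>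

lemma
  assumes q: "q \<in> {0<..<1}"
  shows quantile_le_iff: "quantile F q \<le> x \<longleftrightarrow> q \<le> F x"
    and F_quantile: "F (quantile F q) = q"
proof -
  let ?S = "{x. q \<le> F x}"
  have "\<forall>\<^sub>F x in at_top. q < F x"
    using q order_tendstoD(1)[OF law.cdf_lim_at_top_prob, of q] by (simp add: distribution_function)
  then obtain b where "q < F b" by (auto dest: eventually_happens)
  then have ne: "?S \<noteq> {}" by (auto intro: less_imp_le)
  have "\<forall>\<^sub>F x in at_bot. F x < q"
    using q order_tendstoD(2)[OF law.cdf_lim_at_bot, of q] by (simp add: distribution_function)
  then obtain c where c: "F c < q" by (auto dest: eventually_happens)
  have bdd: "bdd_below ?S"
  proof (rule bdd_belowI)
    fix x assume "x \<in> ?S"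
    then show "c \<le> x" using c F_mono[of x c] by fastforce
  qed
  have "closed ?S"
    using isCont_F by (intro closed_Collect_le continuous_intros)
      (auto intro: continuous_at_imp_continuous_on)
  then have mem: "q \<le> F (quantile F q)"
    using closed_contains_Inf[OF ne bdd] by (simp add: quantile_def)
  show iff: "quantile F q \<le> x \<longleftrightarrow> q \<le> F x" for x
    using mem F_mono[of "quantile F q" x] cInf_lower[OF _ bdd, of x] by (auto simp: quantile_def)
  have "F (quantile F q) \<le> q"
  proof (rule tendsto_upperbound)
    show "(F \<longlongrightarrow> F (quantile F q)) (at_left (quantile F q))"
      using isCont_F[of "quantile F q"] by (auto simp: isCont_def intro: filterlim_mono[OF _ order_refl at_le])
    show "\<forall>\<^sub>F x in at_left (quantile F q). F x \<le> q"
      unfolding eventually_at_left_field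
    proof (intro exI[of _ "quantile F q - 1"] conjI allI impI)
      fix x assume "x < quantile F q"
      then show "F x \<le> q" using iff[of x] by simp
    qed simp
  qed simp
  with mem show "F (quantile F q) = q" by simp
qed

lemma quantile_mono: "mono_on {0<..<1} (quantile F)"
  by (rule monotone_onI) (simp add: quantile_le_iff F_quantile)

text \<open>Some point of the support lies strictly between \<open>l\<close> and \<open>x\<close>,
  and \<open>{..<x}\<close> is an open neighbourhood of it.\<close>

lemma F_pos: "0 < F x" if x: "l < x"
proof -
  obtain z where z: "z \<in> einterval (ereal l) u" "z < x"
    using ereal_dense2[of "ereal l" "min u (ereal x)"] endpoints x by (auto simp: einterval_iff)
  have "z \<in> measure_support (distr M borel X)"
    using z closure_subset by (auto simp: interval_support)
  then have "0 < emeasure (distr M borel X) {..<x}"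
    using z by (auto simp: measure_support_def)
  also have "\<dots> \<le> emeasure (distr M borel X) {..x}"
    by (intro emeasure_mono) auto
  finally show ?thesis
    by (simp add: distribution_function cdf_def law.emeasure_eq_measure)
qed

text \<open>\<open>F\<close> is not constant to the left of \<open>quantile F q\<close>, which is therefore in the support.\<close>

lemma quantile_ge: "l \<le> quantile F q" if q: "q \<in> {0<..<1}"
proof -
  have "quantile F q \<in> measure_support (distr M borel X)"
    unfolding measure_support_def
  proof (clarify)
    fix S :: "real set" assume S: "open S" "quantile F q \<in> S"
    obtain e where e: "e > 0" "{quantile F q - e..quantile F q + e} \<subseteq> S"
      using S by (metis open_contains_cball cball_eq_atLeastAtMost)
    let ?y = "quantile F q - e"
    have "F ?y < F (quantile F q)"
      using quantile_le_iff[OF q, of ?y] F_quantile[OF q] e by simp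
    then have "0 < measure (distr M borel X) {?y<..quantile F q}"
      using law.cdf_diff_eq[of ?y "quantile F q"] e by (simp add: distribution_function)
    also have "\<dots> \<le> measure (distr M borel X) S"
      using S e by (intro law.finite_measure_mono) auto
    finally show "0 < emeasure (distr M borel X) S"
      by (simp add: law.emeasure_eq_measure)
  qed
  moreover have "closure (einterval (ereal l) u) \<subseteq> {l..}"
    by (rule closure_minimal) (auto simp: einterval_iff)
  ultimately show ?thesis
    by (auto simp: interval_support)
qed

lemma F_left_endpoint: "F l = 0"
proof -
  have "F l \<le> q" if "0 < q" "q < 1" for q
    using F_mono[OF quantile_ge[of q]] F_quantile[of q] that by simp
  \<comment> \<open>A positive \<open>F l\<close> would be at most its own half.\<close>
  from this[of "F l / 2"] have "\<not> 0 < F l"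
    using prob_le_1[of "{\<omega> \<in> space M. X \<omega> \<le> l}"] by (auto simp flip: F_eq)
  then show ?thesis using F_nonneg[of l] by simp
qed

lemma quantile_gt: "l < quantile F q" if "q \<in> {0<..<1}"
  using quantile_ge[OF that] F_quantile[OF that] F_left_endpoint that
  by (cases "quantile F q = l") auto

section \<open>Shortfall and excess\<close>

text \<open>
  The function \<open>x \<mapsto> E[(x - X)\<^sup>+]\<close> is the antiderivative of \<open>F\<close> that vanishes at \<open>l\<close>. Its values
  at the quantiles are the integrals in the definition of the order.
\<close>

definition shortfall :: "real \<Rightarrow> real" where
  "shortfall x = expectation (\<lambda>\<omega>. max 0 (x - X \<omega>))"

text \<open>The stop-loss transform of \<open>X\<close>.\<close>

definition excess :: "real \<Rightarrow> real" where
  "excess x = expectation (\<lambda>\<omega>. max 0 (X \<omega> - x))"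

lemma integrable_parts [simp]:
  "integrable M (\<lambda>\<omega>. max 0 (x - X \<omega>))" "integrable M (\<lambda>\<omega>. max 0 (X \<omega> - x))"
  using finite_expectation by (auto intro!: integrable_max)

lemma shortfall_minus_excess: "shortfall x - excess x = x - expectation X"
proof -
  have "shortfall x - excess x = expectation (\<lambda>\<omega>. max 0 (x - X \<omega>) - max 0 (X \<omega> - x))"
    by (simp add: shortfall_def excess_def)
  also have "(\<lambda>\<omega>. max 0 (x - X \<omega>) - max 0 (X \<omega> - x)) = (\<lambda>\<omega>. x - X \<omega>)"
    by (auto simp: max_def)
  finally show ?thesis
    using finite_expectation by (simp add: prob_space)
qed

text \<open>Pointwise, the increment of the positive part is at least \<open>y - x\<close> where
  \<open>X\<close> is at most \<open>x\<close>, is at most \<open>y - x\<close> where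
  \<open>X\<close> is at most \<open>y\<close>, and vanishes elsewhere. With continuity of
  \<open>F\<close> this yields the derivative of \<open>shortfall\<close> without exchanging
  integrals.\<close>

lemma shortfall_diff_bounds:
  assumes "x \<le> y"
  shows "F x * (y - x) \<le> shortfall y - shortfall x" "shortfall y - shortfall x \<le> F y * (y - x)"
proof -
  have ind: "F t * (y - x) = expectation (\<lambda>\<omega>. indicator {\<omega> \<in> space M. X \<omega> \<le> t} \<omega> * (y - x))" for t
    by (simp add: F_eq)
  have diff: "shortfall y - shortfall x = expectation (\<lambda>\<omega>. max 0 (y - X \<omega>) - max 0 (x - X \<omega>))"
    by (simp add: shortfall_def)
  have int: "integrable M (\<lambda>\<omega>. indicator {\<omega> \<in> space M. X \<omega> \<le> t} \<omega> * (y - x))" for t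
    by (intro integrable_mult_left integrable_real_indicator) (auto simp: emeasure_eq_measure)
  show "F x * (y - x) \<le> shortfall y - shortfall x"
    unfolding ind diff using assms
    by (intro integral_mono int Bochner_Integration.integrable_diff integrable_parts)
      (auto simp: indicator_def max_def)
  show "shortfall y - shortfall x \<le> F y * (y - x)"
    unfolding ind diff using assms
    by (intro integral_mono int Bochner_Integration.integrable_diff integrable_parts)
      (auto simp: indicator_def max_def)
qed

lemma shortfall_deriv: "(shortfall has_real_derivative F x) (at x)"
  unfolding has_field_derivative_iff
proof (rule tendsto_sandwich)
  have F: "(F \<longlongrightarrow> F x) (at x)"
    using isCont_F by (simp add: isCont_def)
  show "((\<lambda>y. min (F x) (F y)) \<longlongrightarrow> F x) (at x)" "((\<lambda>y. max (F x) (F y)) \<longlongrightarrow> F x) (at x)"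
    using tendsto_min[OF tendsto_const F, of "F x"] tendsto_max[OF tendsto_const F, of "F x"] by simp_all
  have "min (F x) (F y) \<le> (shortfall y - shortfall x) / (y - x) \<and>
      (shortfall y - shortfall x) / (y - x) \<le> max (F x) (F y)" if "y \<noteq> x" for y
  proof (cases "x < y")
    case True
    then show ?thesis
      using shortfall_diff_bounds[of x y] F_mono[of x y] by (simp add: field_simps)
  next
    case False
    with that have "y < x" by simp
    then show ?thesis
      using shortfall_diff_bounds[of y x] F_mono[of y x] by (simp add: field_simps)
  qed
  then show "\<forall>\<^sub>F y in at x. min (F x) (F y) \<le> (shortfall y - shortfall x) / (y - x)"
    "\<forall>\<^sub>F y in at x. (shortfall y - shortfall x) / (y - x) \<le> max (F x) (F y)"
    by (auto simp: eventually_at_filter)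
qed

lemma shortfall_left_endpoint: "shortfall l = 0"
proof -
  have "prob {\<omega> \<in> space M. X \<omega> \<le> l} = 0"
    using F_left_endpoint by (simp add: F_eq)
  then have "AE \<omega> in M. \<not> X \<omega> \<le> l"
    by (subst (asm) prob_eq_0) auto
  then have "shortfall l = expectation (\<lambda>\<omega>. 0)"
    unfolding shortfall_def by (intro integral_cong_AE) (auto simp: max_def)
  then show ?thesis by simp
qed

lemma shortfall_pos: "0 < shortfall x" if x: "l < x"
proof -
  obtain y where y: "l < y" "y < x" using dense[OF x] by blast
  have "0 < F y * (x - y)" using y F_pos by simp
  also have "\<dots> \<le> shortfall x - shortfall y" using y by (intro shortfall_diff_bounds) simp
  finally have "shortfall y < shortfall x" by simp
  moreover have "0 \<le> shortfall y" by (simp add: shortfall_def)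
  ultimately show ?thesis by simp
qed

lemma integral_F_eq_shortfall:
  assumes "l \<le> x"
  shows "(LBINT t=ereal l..ereal x. F t) = shortfall x"
proof -
  have "(LBINT t=ereal l..ereal x. F t) = shortfall x - shortfall l"
    using isCont_F shortfall_deriv[THEN has_field_derivative_at_within]
    by (intro interval_integral_FTC_finite continuous_at_imp_continuous_on)
      (simp_all add: has_real_derivative_iff_has_vector_derivative)
  then show ?thesis by (simp add: shortfall_left_endpoint)
qed

lemma shortfall_quantile_deriv:
  assumes "q \<in> {0<..<1}"
  shows "((\<lambda>q. shortfall (quantile F q)) has_real_derivative q / f (quantile F q)) (at q)"
  using DERIV_chain2[OF shortfall_deriv quantile_deriv[OF assms]] F_quantile[OF assms] by simp

text \<open>The slope of \<open>shortfall\<close> up to \<open>quantile F q\<close> is at most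
  \<open>q\<close>, while the quantile itself stays bounded near 0. The bound at \<open>1/2\<close>
  is an arbitrary choice.\<close>

lemma shortfall_quantile_at_0: "((\<lambda>q. shortfall (quantile F q)) \<longlongrightarrow> 0) (at_right 0)"
proof (rule tendsto_sandwich)
  have *: "0 \<le> shortfall (quantile F q) \<and> shortfall (quantile F q) \<le> q * (quantile F (1/2) - l)"
    if q: "0 < q" "q < 1/2" for q
  proof -
    have "shortfall (quantile F q) \<le> q * (quantile F q - l)"
      using shortfall_diff_bounds(2)[of l "quantile F q"] quantile_ge[of q] F_quantile[of q] q
      by (simp add: shortfall_left_endpoint)
    also have "\<dots> \<le> q * (quantile F (1/2) - l)"
      using monotone_onD[OF quantile_mono, of q "1/2"] q by (intro mult_left_mono) auto
    finally show ?thesis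
      using shortfall_pos[OF quantile_gt, of q] q by simp
  qed
  show "\<forall>\<^sub>F q in at_right 0. 0 \<le> shortfall (quantile F q)"
    "\<forall>\<^sub>F q in at_right 0. shortfall (quantile F q) \<le> q * (quantile F (1/2) - l)"
    unfolding eventually_at_right_field using * by (auto intro!: exI[of _ "1/2 :: real"])
  show "((\<lambda>q. q * (quantile F (1/2) - l)) \<longlongrightarrow> 0) (at_right 0)"
    by (auto intro!: tendsto_eq_intros)
qed simp

text \<open>Integrability is recorded as well, since the integral of a difference is later split
  into two integrals.\<close>

lemma
  assumes "q \<in> {0<..<1}"
  shows weighted_density_integrable:
      "interval_lebesgue_integrable lborel 0 (ereal q) (\<lambda>s. s * (1 / f (quantile F s)))"
    and weighted_density_integral:
      "(LBINT s=0..ereal q. s * (1 / f (quantile F s))) = shortfall (quantile F q)"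
proof -
  \<comment> \<open>Monotonicity gives measurability, but only inside the unit interval: for
    \<open>p\<close> at most 0 the quantile is the \<open>Inf\<close> of a set unbounded
    below.\<close>
  have [measurable]: "quantile F \<in> borel_measurable (restrict_space borel {0<..<q})"
    using assms by (intro borel_measurable_mono_on_fnc mono_on_subset[OF quantile_mono]) auto
  have "(\<lambda>s. s * (1 / f (quantile F s))) \<in> borel_measurable (restrict_space borel {0<..<q})"
    by (intro borel_measurable_times measurable_restrict_space1[of "\<lambda>s. s"]) measurable
  then have meas: "set_borel_measurable borel {0<..<q} (\<lambda>s. s * (1 / f (quantile F s)))"
    by (subst (asm) borel_measurable_restrict_space_iff)
      (auto simp: set_borel_measurable_def)
  have cont: "isCont (\<lambda>q. shortfall (quantile F q)) q"
    using shortfall_quantile_deriv[OF assms] by (rule DERIV_isCont)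
  have deriv: "((\<lambda>q. shortfall (quantile F q)) has_real_derivative s * (1 / f (quantile F s))) (at s)"
    and nonneg: "0 \<le> s * (1 / f (quantile F s))" if "0 < s" "s < q" for s
    using shortfall_quantile_deriv[of s] density_nonneg that assms by simp_all
  have "0 < q" using assms by simp
  note FTC = interval_integral_FTC_nonneg_measurable
    [OF \<open>0 < q\<close> deriv shortfall_quantile_at_0 cont nonneg meas]
  show "interval_lebesgue_integrable lborel 0 (ereal q) (\<lambda>s. s * (1 / f (quantile F s)))"
    "(LBINT s=0..ereal q. s * (1 / f (quantile F s))) = shortfall (quantile F q)"
    using FTC by (simp_all flip: zero_ereal_def)
qed

text \<open>Almost surely \<open>F (X \<omega>) < 1\<close>, because the opposite event lies in the
  event that \<open>X\<close> exceeds the quantile at \<open>S n\<close>, of probability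
  \<open>1 - S n\<close>. Hence the quantiles eventually pass \<open>X \<omega>\<close>, and
  dominated convergence applies with the positive part of \<open>X - l\<close> as majorant.\<close>

lemma excess_quantile_at_1: "((\<lambda>q. excess (quantile F q)) \<longlongrightarrow> 0) (at_left 1)"
proof (rule tendsto_at_left_sequentially[of 0])
  fix S :: "nat \<Rightarrow> real"
  assume S: "incseq S" "S \<longlonglongrightarrow> 1" "\<And>n. S n < 1" "\<And>n. 0 < S n"
  have [measurable]: "F \<in> borel_measurable borel"
    by (rule borel_measurable_mono) (simp add: mono_def F_mono)
  have le: "prob {\<omega> \<in> space M. 1 \<le> F (X \<omega>)} \<le> 1 - S n" for n
  proof -
    have FS: "F (quantile F (S n)) = S n" using F_quantile[of "S n"] S by simp
    have "prob {\<omega> \<in> space M. 1 \<le> F (X \<omega>)} \<le> prob {\<omega> \<in> space M. \<not> X \<omega> \<le> quantile F (S n)}"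
    proof (rule finite_measure_mono)
      show "{\<omega> \<in> space M. 1 \<le> F (X \<omega>)} \<subseteq> {\<omega> \<in> space M. \<not> X \<omega> \<le> quantile F (S n)}"
      proof clarsimp
        fix \<omega> assume "1 \<le> F (X \<omega>)" "X \<omega> \<le> quantile F (S n)"
        then have "1 \<le> S n" using F_mono[of "X \<omega>" "quantile F (S n)"] FS by simp
        then show False using S(3)[of n] by simp
      qed
    qed measurable
    also have "\<dots> = 1 - S n"
      by (subst prob_neg) (simp_all add: FS flip: F_eq)
    finally show ?thesis .
  qed
  have "prob {\<omega> \<in> space M. 1 \<le> F (X \<omega>)} \<le> 0"
  proof (rule tendsto_lowerbound)
    show "(\<lambda>n. 1 - S n) \<longlonglongrightarrow> 0"
      using tendsto_diff[OF tendsto_const S(2), of 1] by simp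
  qed (simp_all add: le)
  then have "AE \<omega> in M. \<not> 1 \<le> F (X \<omega>)"
    by (subst prob_Collect_eq_0[symmetric]) (simp_all add: measure_le_0_iff)
  then have lim: "AE \<omega> in M. (\<lambda>n. max 0 (X \<omega> - quantile F (S n))) \<longlonglongrightarrow> 0"
  proof eventually_elim
    case (elim \<omega>)
    then have "\<forall>\<^sub>F n in sequentially. F (X \<omega>) < S n"
      using order_tendstoD(1)[OF S(2)] by simp
    then have "\<forall>\<^sub>F n in sequentially. 0 = max 0 (X \<omega> - quantile F (S n))"
    proof eventually_elim
      case (elim n)
      then have "\<not> quantile F (S n) \<le> X \<omega>" using quantile_le_iff[of "S n"] S by auto
      then show ?case by simp
    qed
    then show ?case by (rule Lim_transform_eventually[OF tendsto_const])
  qed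
  have "(\<lambda>n. excess (quantile F (S n))) \<longlonglongrightarrow> expectation (\<lambda>\<omega>. 0)"
    unfolding excess_def
  proof (rule integral_dominated_convergence[where w = "\<lambda>\<omega>. max 0 (X \<omega> - l)"])
    show "AE \<omega> in M. norm (max 0 (X \<omega> - quantile F (S n))) \<le> max 0 (X \<omega> - l)" for n
      using quantile_ge[of "S n"] S by (auto simp: max_def)
  qed (use lim in auto)
  then show "(\<lambda>n. excess (quantile F (S n))) \<longlonglongrightarrow> 0" by simp
qed simp

end

section \<open>The characterization of the qmit order\<close>

theorem theorem2p7:
  fixes M :: "'a measure" and N :: "'b measure"
    and X :: "'a \<Rightarrow> real" and Y :: "'b \<Rightarrow> real"
    and F f G g r :: "real \<Rightarrow> real"
    and lX lY :: real and uX uY :: ereal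
    and n :: nat and p :: "nat \<Rightarrow> real"
  assumes X: "nonneg_rv M X F f lX uX"
    and Y: "nonneg_rv N Y G g lY uY"
    and r: "r = (\<lambda>q. f (quantile F q) / g (quantile G q))"
    and n: "1 \<le> n"
    and modes: "modes_from_increasing r n p"
  shows "qmit_le lX F lY G \<longleftrightarrow>
    (\<exists>m. n = 2 * m \<and>
      (\<forall>i\<in>{1..m}. 0 \<le> (LBINT q=0..ereal (p (2 * i)).
         q * (r (p (2 * i)) * (1 / f (quantile F q)) - 1 / g (quantile G q))))) \<or>
    (\<exists>m. n = 2 * m + 1 \<and>
      (\<forall>i\<in>{1..m}. 0 \<le> (LBINT q=0..ereal (p (2 * i)).
         q * (r (p (2 * i)) * (1 / f (quantile F q)) - 1 / g (quantile G q)))) \<and>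
      (\<exists>L::ereal.
         ((\<lambda>q. ereal (r q * (quantile F q - integral\<^sup>L M X) - (quantile G q - integral\<^sup>L N Y)))
            \<longlongrightarrow> L) (at_left 1) \<and> 0 \<le> L))"
proof -
  interpret X: nonneg_rv M X F f lX uX by (rule X)
  interpret Y: nonneg_rv N Y G g lY uY by (rule Y)
  define A where "A q = X.shortfall (quantile F q)" for q
  define B where "B q = Y.shortfall (quantile G q)" for q
  interpret derivative_ratio A B "\<lambda>q. q / f (quantile F q)" r
  proof
    fix q :: real assume q: "q \<in> {0<..<1}"
    show "(A has_real_derivative q / f (quantile F q)) (at q)"
      unfolding A_def using q by (rule X.shortfall_quantile_deriv)
    have "r q * (q / f (quantile F q)) = q / g (quantile G q)"
      using X.density_quantile_pos[OF q] by (simp add: r)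
    then show "(B has_real_derivative r q * (q / f (quantile F q))) (at q)"
      unfolding B_def using Y.shortfall_quantile_deriv[OF q] by simp
    show "0 < q / f (quantile F q)"
      using X.density_quantile_pos[OF q] q by simp
    show "0 < A q"
      unfolding A_def using q by (intro X.shortfall_pos X.quantile_gt)
  qed (simp_all add: A_def[abs_def] B_def[abs_def] X.shortfall_quantile_at_0 Y.shortfall_quantile_at_0)
  have qmit: "qmit_le lX F lY G \<longleftrightarrow> mono_on {0<..<1} (\<lambda>q. B q / A q)"
    by (simp add: qmit_le_def monotone_on_def A_def B_def X.integral_F_eq_shortfall X.quantile_ge
        Y.integral_F_eq_shortfall Y.quantile_ge)
  have integral: "(LBINT s=0..ereal q. s * (r q * (1 / f (quantile F s)) - 1 / g (quantile G s))) = H q"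
    if q: "q \<in> {0<..<1}" for q
  proof -
    have "r q \<noteq> 0"
      using X.density_quantile_pos[OF q] Y.density_quantile_pos[OF q] by (simp add: r)
    then have "interval_lebesgue_integrable lborel 0 (ereal q) (\<lambda>s. r q * (s * (1 / f (quantile F s))))"
      by (intro interval_lebesgue_integrable_mult_right X.weighted_density_integrable q)
    then have "(LBINT s=0..ereal q. r q * (s * (1 / f (quantile F s))) - s * (1 / g (quantile G s))) = H q"
      using interval_lebesgue_integral_diff(2)[OF _ Y.weighted_density_integrable[OF q]]
        X.weighted_density_integral[OF q] Y.weighted_density_integral[OF q]
      by (simp only: interval_lebesgue_integral_mult_right H_def A_def B_def)
    then show ?thesis by (simp add: algebra_simps)
  qed
  define K where "K q = r q * (quantile F q - integral\<^sup>L M X) - (quantile G q - integral\<^sup>L N Y)" for q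
  define d where "d q = Y.excess (quantile G q) - r q * X.excess (quantile F q)" for q
  \<comment> \<open>Each centred quantile is a shortfall minus an excess; the shortfalls make up
    \<open>H\<close> and the excesses make up \<open>d\<close>.\<close>
  have K: "K q = H q + d q" for q
    unfolding K_def X.shortfall_minus_excess[symmetric] Y.shortfall_minus_excess[symmetric]
    by (simp add: H_def d_def A_def B_def algebra_simps)
  \<comment> \<open>For odd \<open>n\<close> the ratio \<open>r\<close> is decreasing on the last
    piece, which bounds it near 1 and makes its product with the vanishing excess of
    \<open>X\<close> vanish too.\<close>
  have lim: "((\<lambda>q. ereal (K q)) \<longlongrightarrow> L) (at_left 1) \<longleftrightarrow> ((\<lambda>q. ereal (H q)) \<longlongrightarrow> L) (at_left 1)"
    if "odd n" for L
  proof -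
    have anti: "antimono_on {p n<..<1} r" and pn: "p n < 1"
      using modes \<open>odd n\<close> by (auto simp: modes_from_increasing_def)
    \<comment> \<open>A point strictly between \<open>p n\<close> and 1; the maximum with 0 makes
      its positivity immediate.\<close>
    define c where "c = (max 0 (p n) + 1) / 2"
    have c: "c \<in> {p n<..<1}" "0 < c" using pn by (auto simp: c_def)
    have r_bound: "norm (r q) \<le> r c" if "c < q" "q < 1" for q
    proof -
      have "0 < f (quantile F q)" "0 < g (quantile G q)"
        using X.density_quantile_pos[of q] Y.density_quantile_pos[of q] that c by auto
      then have "0 \<le> r q" by (simp add: r)
      then show ?thesis using monotone_onD[OF anti, of c q] that c by auto
    qed
    have "((\<lambda>q. r q * X.excess (quantile F q)) \<longlongrightarrow> 0) (at_left 1)"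
    proof (rule lim_null_mult_left_bounded)
      show "\<forall>\<^sub>F q in at_left 1. norm (r q) \<le> r c"
        using r_bound c by (auto simp: eventually_at_left intro!: exI[of _ c])
    qed (rule X.excess_quantile_at_1)
    from tendsto_diff[OF Y.excess_quantile_at_1 this]
    have d: "(d \<longlongrightarrow> 0) (at_left 1)"
      by (simp add: d_def[abs_def])
    show ?thesis
    proof
      assume "((\<lambda>q. ereal (K q)) \<longlongrightarrow> L) (at_left 1)"
      \<comment> \<open>Adding a real null function preserves the limit \<open>L\<close> even when
        it is infinite.\<close>
      from tendsto_add_ereal_general1[OF _ this tendsto_ereal[OF tendsto_minus[OF d]]]
      show "((\<lambda>q. ereal (H q)) \<longlongrightarrow> L) (at_left 1)" by (simp add: K flip: zero_ereal_def)
    next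
      assume "((\<lambda>q. ereal (H q)) \<longlongrightarrow> L) (at_left 1)"
      from tendsto_add_ereal_general1[OF _ this tendsto_ereal[OF d]]
      show "((\<lambda>q. ereal (K q)) \<longlongrightarrow> L) (at_left 1)"
        by (simp add: K flip: zero_ereal_def)
    qed
  qed
  \<comment> \<open>The bound on \<open>m\<close> keeps every \<open>p (2 * i)\<close> inside the
    unit interval. Both \<open>n = 2 * m\<close> and \<open>n = 2 * m + 1\<close> supply it.\<close>
  have integrals: "(\<forall>i\<in>{1..m}. 0 \<le> (LBINT q=0..ereal (p (2 * i)).
         q * (r (p (2 * i)) * (1 / f (quantile F q)) - 1 / g (quantile G q)))) \<longleftrightarrow>
      (\<forall>i\<in>{1..m}. 0 \<le> H (p (2 * i)))" if "2 * m \<le> n" for m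
  proof (rule ball_cong[OF refl])
    fix i assume "i \<in> {1..m}"
    then have "p (2 * i) \<in> {0<..<1}"
      using that by (intro modes_in_unit_interval[OF modes]) auto
    then show "0 \<le> (LBINT q=0..ereal (p (2 * i)).
         q * (r (p (2 * i)) * (1 / f (quantile F q)) - 1 / g (quantile G q))) \<longleftrightarrow> 0 \<le> H (p (2 * i))"
      by (simp only: integral)
  qed
  show ?thesis
    unfolding qmit mono_on_ratio_iff H_nonneg_iff[OF modes n] K_def[symmetric]
    by (intro arg_cong2[of _ _ _ _ "(\<or>)"] ex_cong1 conj_cong refl integrals[symmetric])
      (simp_all add: lim)
qed

end
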